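(* The polynomials $P_m(x)$ obey the Christoffel–Darboux formula $$\sum_{m=0}^nP_m(y)P_m(x)=\frac{P_{n+1}(x)P_n(y)-P_{n+1}(y)P_n(x)}{x-y},$$ the confluent form of which (i.e., for $y\to x$) is $$\sum_{k=0}^nP_k^2(x)=P_{n+1}'(x)P_n(x)-P_{n+1}(x)P_n'(x).$$ They also satisfy the relation $$\frac{dP_m(x)}{dx}=\frac1{x(4+x)}\left\{-(2m-1)P_{m-1}(x)+[m(x+2)-1]P_m(x)\right\},$$ and have the raising and lowering operators $$R_m=x(x+4)\frac{d}{dx}+m(x+2)+x+3,\qquad L_m=-x(x+4)\frac{d}{dx}+m(x+2)-1,$$ such that $R_mP_m(x)=(2m+3)P_{m+1}(x)$ and $L_mP_m(x)=(2m-1)P_{m-1}(x)$. The ordinary differential equation for $P_m(x)$ can then be written in terms of these operators. The polynomials $Q_m(x)$ obey the quadratic identity $$Q_m^2(x)=Q_{2m}(x)+2,$$ have the generating function $$\sum_{m=0}^\infty\frac{(1/2)_m}{m!}Q_m(x)r^m=R^{-1}(1-r+R)^{1/2}(1+r+R)^{1/2},$$ where $R=(1-2r-xr+r^2)^{1/2}$, and satisfy the differential relation $$\frac{d}{dx}Q_m(x)=\frac{2m\sin[m\cos^{-1}(1+x/2)]}{\sqrt{-x(4+x)}}.$$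
   Context: The polynomials of degree $m$ are defined by $$P_m(x)=\sum_{k=0}^{m}\frac{2m+1}{2k+1}\binom{m+k}{2k}x^{k},\qquad Q_m(x)=\sum_{k=0}^{m}\frac{m}{k}\binom{m+k-1}{2k-1}x^k,$$ where the $k=0$ term of $Q_m$ is read as $2$ by the limit $\lim_{k\to0}\frac{m}{k}\binom{m+k-1}{2k-1}=2$. The ordinary differential equation for $P_m$ referred to is $x(4+x)P_m''(x)+2(x+3)P_m'(x)-m(m+1)P_m(x)=0$. $(a)_m=a(a+1)\cdots(a+m-1)$ is the Pochhammer symbol.
   Formalization: Three printed constants are false for P_m as defined (e.g. R_0 P_0 = P_1, L_1 P_1 = 3P_0) and are corrected: −(2m−1)P_{m−1} in dP_m/dx becomes −(2m+1)P_{m−1}, R_m P_m = (2m+1)P_{m+1}, and L_m P_m = (2m+1)P_{m−1}. *)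

theory Defs
  imports
    "HOL-Computational_Algebra.Polynomial"
    "HOL-Complex_Analysis.Complex_Analysis"
begin

definition P :: "nat \<Rightarrow> complex poly" where
  "P m = (\<Sum>k=0..m. monom (of_nat (2*m+1) / of_nat (2*k+1) * of_nat ((m+k) choose (2*k))) k)"

text \<open>
  The constant term of \<open>Q m\<close> is the limit of \<open>m/k * binom (m+k-1) (2k-1)\<close> as \<open>k\<close> tends to 0,
  which equals 2 (also for \<open>m = 0\<close>).
\<close>

definition Q :: "nat \<Rightarrow> complex poly" where
  "Q m = (\<Sum>k=0..m. monom
     (if k = 0 then 2 else of_nat m / of_nat k * of_nat ((m+k-1) choose (2*k-1))) k)"

definition ode_P :: "nat \<Rightarrow> (complex \<Rightarrow> complex) \<Rightarrow> complex \<Rightarrow> complex" where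
  "ode_P m f x = x * (4 + x) * (deriv ^^ 2) f x + 2 * (x + 3) * deriv f x
                 - of_nat m * (of_nat m + 1) * f x"

text \<open>
  The ladder operators. On \<open>P m\<close>, normalised to be monic as above, both of them act with the
  factor \<open>2m+1\<close>; the factors \<open>2m+3\<close> (raising) and \<open>2m-1\<close> (lowering) are those
  for the polynomials \<open>P m / (2m+1)\<close>, whose value at 0 is 1.
\<close>

definition raise_op :: "nat \<Rightarrow> (complex \<Rightarrow> complex) \<Rightarrow> complex \<Rightarrow> complex" where
  "raise_op m f x = x * (x + 4) * deriv f x + (of_nat m * (x + 2) + x + 3) * f x"

definition lower_op :: "nat \<Rightarrow> (complex \<Rightarrow> complex) \<Rightarrow> complex \<Rightarrow> complex" where
  "lower_op m f x = - x * (x + 4) * deriv f x + (of_nat m * (x + 2) - 1) * f x"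

end

theory Submission
  imports Defs
begin

text \<open>
  Both families are Chebyshev polynomials in disguise. Writing \<open>x = 2 cos t - 2\<close>, one has
  \<open>Q m x = 2 cos (m t)\<close> and \<open>P m x = sin ((2 m + 1) t / 2) / sin (t / 2)\<close>, so \<open>x + 2 = 2 cos t\<close>
  and both families solve the recurrence \<open>p (m + 2) = (x + 2) p (m + 1) - p m\<close>. Here the
  recurrence is obtained directly from the coefficients: each is an integer combination of
  two binomial coefficients (\<open>coeff_P\<close>, \<open>coeff_Q\<close>), and the recurrence is a second difference
  of Pascal's rule.

  For \<open>P\<close> everything follows from the recurrence. In the Christoffel--Darboux formula
  consecutive numerators differ by \<open>(x - y) P (n + 1) x P (n + 1) y\<close>, so the sum telescopes;
  the confluent form is its limit. The raising relation is proved by induction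
  (\<open>raise_P\<close>), and the lowering relation is the raising relation combined with the recurrence,
  since the derivative cancels in the sum of the two operators. For any holomorphic \<open>f\<close>, the
  product of the two ladder operators, in either order and with adjacent indices, maps \<open>f\<close> to a
  constant multiple of \<open>f\<close> minus \<open>x (x + 4)\<close> times the left-hand side of the differential
  equation. The equation is therefore equivalent to the ladder form away from \<open>0\<close> and \<open>-4\<close>, and at these two points by continuity.

  For \<open>Q\<close> the parametrisation \<open>Q m (u + v - 2) = u ^ m + v ^ m\<close> with \<open>u v = 1\<close> does the work:
  the quadratic identity is the double-angle formula, the derivative is the chain rule, and the
  generating function splits into two binomial series with sum
  \<open>(1 - u r) powr (-1/2) + (1 - v r) powr (-1/2)\<close>. That this equals the closed form is an algebraic
  identity after squaring; the sign is right because \<open>1 - u r\<close>, \<open>1 - v r\<close> and \<open>1 \<plusminus> r + R\<close> all lie in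
  the right half-plane (\<open>inverse_csqrt_add\<close>).
\<close>

section \<open>Coefficients and the three-term recurrence\<close>

lemma binomial_second_difference:
  "(n + 2 choose (k + 2)) + (n choose (k + 2)) = 2 * (n + 1 choose (k + 2)) + (n choose k)"
  by simp

lemma binomial_absorb_ratio: "Suc k * (n choose Suc k) = (n - k) * (n choose k)"
  by (simp only: binomial_absorption binomial_absorb_comp)

text \<open>
  The quotient \<open>(2 m + 1) / (2 k + 1)\<close> equals \<open>1 + 2 (m - k) / (2 k + 1)\<close>, and the factor
  \<open>(m - k) / (2 k + 1)\<close> raises the lower index of the binomial coefficient by one. For \<open>k > m\<close>
  both binomial coefficients vanish.
\<close>
lemma coeff_P:
  "coeff (P m) k = of_nat ((m + k choose (2 * k)) + 2 * (m + k choose (2 * k + 1)))"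
proof (cases "k \<le> m")
  case True
  have "Suc (2*k) * (m + k choose Suc (2*k)) = (m + k - 2*k) * (m + k choose (2*k))"
    by (rule binomial_absorb_ratio)
  moreover have "m + k - 2*k = m - k" by simp
  ultimately have "(2*k+1) * (m + k choose (2*k+1)) = (m - k) * (m + k choose (2*k))" by simp
  hence "of_nat ((2*k+1) * (m + k choose (2*k+1))) = (of_nat ((m - k) * (m + k choose (2*k))) :: complex)"
    by (simp only:)
  hence "(2 * of_nat k + 1) * of_nat (m + k choose (2*k+1))
      = (of_nat m - of_nat k) * (of_nat (m + k choose (2*k)) :: complex)"
    using True by (simp add: of_nat_diff algebra_simps)
  hence "(2 * of_nat m + 1) * of_nat (m + k choose (2*k))
      = (of_nat (m + k choose (2*k)) + 2 * of_nat (m + k choose (2*k+1))) * (2 * of_nat k + 1 :: complex)"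
    by algebra
  moreover have "of_nat (Suc (2 * k)) \<noteq> (0 :: complex)"
    by (simp only: of_nat_eq_0_iff)
  hence "2 * of_nat k + 1 \<noteq> (0 :: complex)"
    by (simp add: add.commute)
  ultimately have "(2 * of_nat m + 1) / (2 * of_nat k + 1) * of_nat (m + k choose (2*k))
      = of_nat (m + k choose (2*k)) + 2 * (of_nat (m + k choose (2*k+1)) :: complex)"
    by (simp only: times_divide_eq_left nonzero_mult_div_cancel_right not_False_eq_True)
  with True show ?thesis
    by (simp add: P_def coeff_sum add.commute)
next
  case False
  thus ?thesis by (simp add: P_def coeff_sum binomial_eq_0)
qed

text \<open>
  Here \<open>m / k = (m + k) / (2 k) + (m - k) / (2 k)\<close>, and either summand turns the given binomial
  coefficient into one with lower index \<open>2 k\<close>. At \<open>k = 0\<close> the sum is \<open>1 + 1\<close>, the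
  limiting value \<open>2\<close>.
\<close>
lemma coeff_Q:
  "coeff (Q m) k = of_nat ((m + k choose (2 * k)) + (m + k - 1 choose (2 * k)))"
proof (cases k)
  case 0
  thus ?thesis by (simp add: Q_def coeff_sum)
next
  case (Suc j)
  show ?thesis
  proof (cases "k \<le> m")
    case True
    obtain N where N: "m + k = Suc N" using Suc by simp
    define B where "B = (N choose (2*j+1))"
    have "Suc (Suc (2*j)) * (N choose Suc (Suc (2*j))) = (N - Suc (2*j)) * B"
      unfolding B_def using binomial_absorb_ratio[of "Suc (2*j)" N] by simp
    moreover have "N - Suc (2*j) = m - k" using N Suc by simp
    ultimately have 1: "2 * k * (N choose (2*k)) = (m - k) * B" using Suc by simp
    hence "of_nat (2 * k * (N choose (2*k))) = (of_nat ((m - k) * B) :: complex)"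
      by (simp only:)
    hence 1: "2 * of_nat k * of_nat (N choose (2*k)) = (of_nat m - of_nat k) * (of_nat B :: complex)"
      using True by (simp add: of_nat_diff)
    have 2: "(m + k choose (2*k)) = B + (N choose (2*k))"
      using N Suc by (simp add: B_def)
    have "of_nat k \<noteq> (0 :: complex)" unfolding Suc by (simp only: of_nat_eq_0_iff)
    with 1 have "of_nat m / of_nat k * (of_nat B :: complex)
       = of_nat ((m + k choose (2*k)) + (N choose (2*k)))"
      unfolding 2 by (simp add: divide_simps) (simp add: algebra_simps)
    moreover have "m + k - 1 = N" "2 * k - 1 = 2*j+1" using N Suc by auto
    ultimately show ?thesis
      using True Suc by (simp add: Q_def coeff_sum B_def del: binomial_Suc_Suc)
  next
    case False
    thus ?thesis by (simp add: Q_def coeff_sum binomial_eq_0)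
  qed
qed

lemma coeff_mult_linear_Suc:
  "coeff ([:2, 1:] * (p :: complex poly)) (Suc k) = 2 * coeff p (Suc k) + coeff p k"
  by simp

lemma P_recurrence: "P (Suc (Suc m)) = [:2, 1:] * P (Suc m) - P m"
proof (rule poly_eqI)
  fix k
  show "coeff (P (Suc (Suc m))) k = coeff ([:2, 1:] * P (Suc m) - P m) k"
  proof (cases k)
    case 0
    thus ?thesis by (simp add: coeff_P)
  next
    case (Suc j)
    let ?c = "\<lambda>m k. (m + k choose (2 * k)) + 2 * (m + k choose (2 * k + 1))"
    have "?c (Suc (Suc m)) (Suc j) + ?c m (Suc j) = 2 * ?c (Suc m) (Suc j) + ?c (Suc m) j"
      using binomial_second_difference[of "m + j + 1" "2 * j"]
        binomial_second_difference[of "m + j + 1" "2 * j + 1"]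
      by (simp del: binomial_Suc_Suc)
    from arg_cong[OF this, of "of_nat :: nat \<Rightarrow> complex"]
    have "of_nat (?c (Suc (Suc m)) (Suc j)) + of_nat (?c m (Suc j))
        = (2 * of_nat (?c (Suc m) (Suc j)) + of_nat (?c (Suc m) j) :: complex)"
      by (simp only: of_nat_add of_nat_mult of_nat_numeral)
    thus ?thesis
      unfolding Suc coeff_diff coeff_mult_linear_Suc coeff_P
      by (simp only: eq_diff_eq)
  qed
qed

lemma Q_recurrence: "Q (Suc (Suc m)) = [:2, 1:] * Q (Suc m) - Q m"
proof (rule poly_eqI)
  fix k
  show "coeff (Q (Suc (Suc m))) k = coeff ([:2, 1:] * Q (Suc m) - Q m) k"
  proof (cases k)
    case 0
    thus ?thesis by (simp add: coeff_Q)
  next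
    case (Suc j)
    let ?c = "\<lambda>m k. (m + k choose (2 * k)) + (m + k - 1 choose (2 * k))"
    have "?c (Suc (Suc m)) (Suc j) + ?c m (Suc j) = 2 * ?c (Suc m) (Suc j) + ?c (Suc m) j"
      using binomial_second_difference[of "m + j + 1" "2 * j"]
        binomial_second_difference[of "m + j" "2 * j"]
      by (simp del: binomial_Suc_Suc)
    from arg_cong[OF this, of "of_nat :: nat \<Rightarrow> complex"]
    have "of_nat (?c (Suc (Suc m)) (Suc j)) + of_nat (?c m (Suc j))
        = (2 * of_nat (?c (Suc m) (Suc j)) + of_nat (?c (Suc m) j) :: complex)"
      by (simp only: of_nat_add of_nat_mult of_nat_numeral)
    thus ?thesis
      unfolding Suc coeff_diff coeff_mult_linear_Suc coeff_Q
      by (simp only: eq_diff_eq)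
  qed
qed

lemma poly_P_0 [simp]: "poly (P 0) x = 1"
  and poly_P_1: "poly (P (Suc 0)) x = x + 3"
  by (simp_all add: P_def poly_monom choose_two)

lemma poly_Q_0 [simp]: "poly (Q 0) x = 2"
  and poly_Q_1: "poly (Q (Suc 0)) x = x + 2"
  by (simp_all add: Q_def poly_monom)

lemma poly_P_Suc_Suc:
  "poly (P (Suc (Suc m))) x = (x + 2) * poly (P (Suc m)) x - poly (P m) x"
  unfolding P_recurrence[of m] by (simp add: algebra_simps)

lemma poly_Q_Suc_Suc:
  "poly (Q (Suc (Suc m))) x = (x + 2) * poly (Q (Suc m)) x - poly (Q m) x"
  unfolding Q_recurrence[of m] by (simp add: algebra_simps)

section \<open>The Christoffel--Darboux formula\<close>

lemma Christoffel_Darboux_P: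
  "(x - y) * (\<Sum>k=0..n. poly (P k) y * poly (P k) x)
     = poly (P (Suc n)) x * poly (P n) y - poly (P (Suc n)) y * poly (P n) x"
proof (induction n)
  case 0
  show ?case by (simp add: poly_P_1)
next
  case (Suc n)
  then show ?case
    by (simp add: poly_P_Suc_Suc[of n] distrib_left) (simp add: algebra_simps)
qed

lemma deriv_poly: "deriv (poly p) = poly (pderiv p)"
  by (intro ext DERIV_imp_deriv poly_DERIV)

lemma Christoffel_Darboux_P_tendsto:
  "((\<lambda>z. (poly (P (Suc n)) x * poly (P n) z - poly (P (Suc n)) z * poly (P n) x) / (x - z))
     \<longlongrightarrow> (\<Sum>k=0..n. (poly (P k) x)^2)) (at x)"
proof -
  have "((\<lambda>z. \<Sum>k=0..n. poly (P k) z * poly (P k) x) \<longlongrightarrow> (\<Sum>k=0..n. poly (P k) x * poly (P k) x)) (at x)"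
    by (intro tendsto_intros poly_isCont[unfolded isCont_def])
  moreover have "\<forall>\<^sub>F z in at x. (\<Sum>k=0..n. poly (P k) z * poly (P k) x)
      = (poly (P (Suc n)) x * poly (P n) z - poly (P (Suc n)) z * poly (P n) x) / (x - z)"
    unfolding Christoffel_Darboux_P[symmetric]
    by (auto simp: eventually_at_filter)
  ultimately show ?thesis
    unfolding power2_eq_square by (rule Lim_transform_eventually)
qed

text \<open>
  The quotient in the Christoffel--Darboux formula is also the difference quotient, at \<open>x\<close>, of the
  function that freezes one factor of each product; so its limit is a derivative.
\<close>
lemma Christoffel_Darboux_P_confluent:
  "(\<Sum>k=0..n. (poly (P k) x)^2)
     = poly (pderiv (P (Suc n))) x * poly (P n) x - poly (P (Suc n)) x * poly (pderiv (P n)) x"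
proof -
  let ?f = "\<lambda>z. poly (P (Suc n)) z * poly (P n) x - poly (P (Suc n)) x * poly (P n) z"
  have "(?f has_field_derivative
      poly (pderiv (P (Suc n))) x * poly (P n) x - poly (P (Suc n)) x * poly (pderiv (P n)) x) (at x)"
    by (auto intro!: derivative_eq_intros)
  hence "((\<lambda>z. (?f z - ?f x) / (z - x)) \<longlongrightarrow>
      poly (pderiv (P (Suc n))) x * poly (P n) x - poly (P (Suc n)) x * poly (pderiv (P n)) x) (at x)"
    by (simp add: has_field_derivative_iff)
  moreover have "(?f z - ?f x) / (z - x)
      = (poly (P (Suc n)) x * poly (P n) z - poly (P (Suc n)) z * poly (P n) x) / (x - z)" for z
    by (subst minus_divide_divide[symmetric]) simp
  ultimately have "((\<lambda>z. (poly (P (Suc n)) x * poly (P n) z - poly (P (Suc n)) z * poly (P n) x) / (x - z)) \<longlongrightarrow>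
      poly (pderiv (P (Suc n))) x * poly (P n) x - poly (P (Suc n)) x * poly (pderiv (P n)) x) (at x)"
    by (simp only:)
  with Christoffel_Darboux_P_tendsto show ?thesis
    by (rule tendsto_unique[OF at_neq_bot])
qed

section \<open>Ladder operators\<close>

text \<open>
  In the induction step, differentiating the recurrence expresses \<open>P' (m + 2)\<close> by \<open>P (m + 1)\<close>,
  \<open>P' (m + 1)\<close> and \<open>P' m\<close>. The two hypotheses eliminate the derivatives, and the recurrence then
  leaves an identity in \<open>P m\<close> and \<open>P (m + 1)\<close>.
\<close>
lemma raise_P: "raise_op m (poly (P m)) x = (2 * of_nat m + 1) * poly (P (Suc m)) x"
proof -
  have "x * (x + 4) * poly (pderiv (P m)) x + (of_nat m * (x + 2) + x + 3) * poly (P m) x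
      = (2 * of_nat m + 1) * poly (P (Suc m)) x"
  proof (induction m rule: induct_nat_012)
    case 0
    have "P 0 = 1" by (simp add: P_def monom_0 one_pCons)
    thus ?case by (simp add: poly_P_1)
  next
    case 1
    have "P (Suc 0) = [:3, 1:]" by (simp add: P_def monom_0 monom_Suc choose_two)
    thus ?case by (simp add: poly_P_Suc_Suc pderiv_pCons algebra_simps)
  next
    case (ge2 m)
    have d: "poly (pderiv (P (Suc (Suc m)))) x
        = poly (P (Suc m)) x + (x + 2) * poly (pderiv (P (Suc m))) x - poly (pderiv (P m)) x"
      unfolding P_recurrence[of m]
      by (simp add: pderiv_diff pderiv_mult pderiv_add pderiv_smult pderiv_pCons algebra_simps)
    show ?case
      using ge2 unfolding d poly_P_Suc_Suc of_nat_Suc by algebra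
  qed
  thus ?thesis by (simp add: raise_op_def deriv_poly)
qed

lemma lower_P:
  "lower_op (Suc m) (poly (P (Suc m))) x = (2 * of_nat m + 3) * poly (P m) x"
proof -
  \<comment> \<open>The derivatives cancel, so the sum of the two operators is a multiplication operator.\<close>
  have "raise_op (Suc m) f x + lower_op (Suc m) f x = (2 * of_nat m + 3) * (x + 2) * f x" for f
    by (simp add: raise_op_def lower_op_def algebra_simps)
  from this[of "poly (P (Suc m))"] show ?thesis
    by (simp add: raise_P poly_P_Suc_Suc algebra_simps)
qed

text \<open>
  This product and the one in the opposite order are the factorisations of the differential
  equation. In both, the constant arises as
  \<open>(m + 1)\<^sup>2 (z + 2)\<^sup>2 - 1 - (m + 1)\<^sup>2 z (z + 4) = 4 (m + 1)\<^sup>2 - 1\<close>.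
\<close>
lemma lower_raise:
  assumes "open S" "f holomorphic_on S" "z \<in> S"
  shows "lower_op (m + 1) (raise_op m f) z
    = (2 * of_nat m + 1) * (2 * of_nat m + 3) * f z - z * (z + 4) * ode_P m f z"
proof -
  have "(f has_field_derivative deriv f z) (at z)"
    "(deriv f has_field_derivative deriv (deriv f) z) (at z)"
    using assms holomorphic_deriv holomorphic_derivI by blast+
  hence "(raise_op m f has_field_derivative
      (2 * z + 4) * deriv f z + z * (z + 4) * deriv (deriv f) z
      + (of_nat m + 1) * f z + (of_nat m * (z + 2) + z + 3) * deriv f z) (at z)"
    unfolding raise_op_def by (auto intro!: derivative_eq_intros simp: algebra_simps)
  hence "deriv (raise_op m f) z =
      (2 * z + 4) * deriv f z + z * (z + 4) * deriv (deriv f) z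
      + (of_nat m + 1) * f z + (of_nat m * (z + 2) + z + 3) * deriv f z"
    by (rule DERIV_imp_deriv)
  thus ?thesis
    by (simp add: lower_op_def raise_op_def ode_P_def numeral_2_eq_2) (simp add: algebra_simps)
qed

lemma raise_lower:
  assumes "open S" "f holomorphic_on S" "z \<in> S"
  shows "raise_op m (lower_op (m + 1) f) z
    = (2 * of_nat m + 1) * (2 * of_nat m + 3) * f z - z * (z + 4) * ode_P (m + 1) f z"
proof -
  have "(f has_field_derivative deriv f z) (at z)"
    "(deriv f has_field_derivative deriv (deriv f) z) (at z)"
    using assms holomorphic_deriv holomorphic_derivI by blast+
  hence "(lower_op (m + 1) f has_field_derivative
      - (2 * z + 4) * deriv f z - z * (z + 4) * deriv (deriv f) z
      + (of_nat m + 1) * f z + ((of_nat m + 1) * (z + 2) - 1) * deriv f z) (at z)"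
    unfolding lower_op_def by (auto intro!: derivative_eq_intros simp: algebra_simps)
  hence "deriv (lower_op (m + 1) f) z =
      - (2 * z + 4) * deriv f z - z * (z + 4) * deriv (deriv f) z
      + (of_nat m + 1) * f z + ((of_nat m + 1) * (z + 2) - 1) * deriv f z"
    by (rule DERIV_imp_deriv)
  thus ?thesis
    by (simp add: lower_op_def raise_op_def ode_P_def numeral_2_eq_2) (simp add: algebra_simps)
qed

text \<open>
  The leading coefficient \<open>z (z + 4)\<close> may be cancelled even at its zeros: a non-empty open set on
  which \<open>g\<close> does not vanish cannot be contained in \<open>{0, -4}\<close>.
\<close>
lemma vanishes_if_quadratic_multiple_vanishes:
  fixes g :: "complex \<Rightarrow> complex"
  assumes "open S" "continuous_on S g" "\<And>z. z \<in> S \<Longrightarrow> z * (z + 4) * g z = 0" "z \<in> S"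
  shows "g z = 0"
proof -
  have "open (S \<inter> g -` (- {0}))"
    using assms(1,2) by (intro continuous_open_preimage) auto
  moreover have "S \<inter> g -` (- {0}) \<subseteq> {0, -4}"
    using assms(3) by (auto simp: add_eq_0_iff2)
  hence "finite (S \<inter> g -` (- {0}))" by (rule finite_subset) simp
  ultimately have "S \<inter> g -` (- {0}) = {}"
    using finite_imp_not_open by blast
  with assms(4) show ?thesis by auto
qed

lemma continuous_on_ode_P:
  assumes "open S" "f holomorphic_on S"
  shows "continuous_on S (ode_P m f)"
proof -
  have "continuous_on S f" "continuous_on S (deriv f)" "continuous_on S (deriv (deriv f))"
    using assms by (auto intro!: holomorphic_deriv holomorphic_on_imp_continuous_on)
  thus ?thesis
    unfolding ode_P_def numeral_2_eq_2 by (auto intro!: continuous_intros)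
qed

lemma ode_iff_ladder:
  assumes "open S" "f holomorphic_on S"
    and "\<And>z. z \<in> S \<Longrightarrow> F z = c * f z - z * (z + 4) * ode_P m f z"
  shows "(\<forall>z\<in>S. ode_P m f z = 0) \<longleftrightarrow> (\<forall>z\<in>S. F z = c * f z)"
  using assms vanishes_if_quadratic_multiple_vanishes[OF assms(1) continuous_on_ode_P[OF assms(1,2)]]
  by auto

lemma ode_P_iff_lower_raise:
  assumes "open S" "f holomorphic_on S"
  shows "(\<forall>z\<in>S. ode_P m f z = 0) \<longleftrightarrow>
    (\<forall>z\<in>S. lower_op (m + 1) (raise_op m f) z = (2 * of_nat m + 1) * (2 * of_nat m + 3) * f z)"
  by (rule ode_iff_ladder[OF assms lower_raise[OF assms]])

lemma ode_P_iff_raise_lower: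
  assumes "open S" "f holomorphic_on S"
  shows "(\<forall>z\<in>S. ode_P (m + 1) f z = 0) \<longleftrightarrow>
    (\<forall>z\<in>S. raise_op m (lower_op (m + 1) f) z = (2 * of_nat m + 1) * (2 * of_nat m + 3) * f z)"
  by (rule ode_iff_ladder[OF assms raise_lower[OF assms]])

lemma ode_P_P: "ode_P m (poly (P m)) x = 0"
proof -
  have "raise_op m (poly (P m)) = poly (smult (2 * of_nat m + 1) (P (Suc m)))"
    by (simp add: raise_P fun_eq_iff)
  moreover have "lower_op k (poly (smult c p)) z = c * lower_op k (poly p) z" for k c p z
    by (simp add: lower_op_def deriv_poly pderiv_smult algebra_simps)
  ultimately have "\<forall>z\<in>UNIV. lower_op (m + 1) (raise_op m (poly (P m))) z
      = (2 * of_nat m + 1) * (2 * of_nat m + 3) * poly (P m) z"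
    by (simp add: lower_P)
  moreover have "poly (P m) holomorphic_on UNIV"
    by (intro holomorphic_intros)
  ultimately show ?thesis
    using ode_P_iff_lower_raise[OF open_UNIV] by blast
qed

section \<open>The second family\<close>

lemma poly_Q_Joukowski:
  assumes "u * v = 1"
  shows "poly (Q m) (u + v - 2) = u ^ m + v ^ m"
proof (induction m rule: induct_nat_012)
  case (ge2 m)
  have "u ^ Suc (Suc m) + v ^ Suc (Suc m)
      = (u + v) * (u ^ Suc m + v ^ Suc m) - u * v * (u ^ m + v ^ m)"
    by (simp add: algebra_simps)
  with ge2 assms show ?case by (simp add: poly_Q_Suc_Suc)
qed (simp_all add: poly_Q_1)

text \<open>
  Since the complex cosine is surjective, this determines \<open>Q m\<close> at every point, not only on the
  real interval from \<open>-4\<close> to \<open>0\<close>.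
\<close>
lemma poly_Q_cos: "poly (Q m) (2 * cos t - 2) = 2 * cos (of_nat m * t)"
proof -
  have "exp (\<i> * t) * exp (-(\<i> * t)) = 1"
    by (simp flip: exp_add)
  moreover have cos: "2 * cos s = exp (\<i> * s) + exp (-(\<i> * s))" for s
    by (simp add: cos_exp_eq)
  ultimately show ?thesis
    using poly_Q_Joukowski[of "exp (\<i> * t)" "exp (-(\<i> * t))" m]
    by (simp add: cos mult_ac flip: exp_of_nat_mult)
qed

lemma exists_cos_parameter: "\<exists>t. x = 2 * cos t - 2" for x :: complex
  by (rule exI[of _ "Arccos (1 + x / 2)"]) simp

lemma Q_square: "(poly (Q m) x)^2 = poly (Q (2 * m)) x + 2"
proof -
  obtain t where x: "x = 2 * cos t - 2" using exists_cos_parameter by blast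
  have "cos (of_nat (2 * m) * t) = 2 * cos (of_nat m * t) ^ 2 - 1"
    using cos_double_cos[of "of_nat m * t"] by (simp add: mult_ac)
  thus ?thesis unfolding x poly_Q_cos by (simp add: power_mult_distrib)
qed

text \<open>
  This holds on the whole plane, branch cuts included: the number \<open>z + \<i> csqrt (1 - z\<^sup>2)\<close> whose
  logarithm defines \<open>Arccos z\<close> has the inverse \<open>z - \<i> csqrt (1 - z\<^sup>2)\<close>.
\<close>
lemma sin_Arccos_csqrt: "sin (Arccos z) = csqrt (1 - z\<^sup>2)"
proof -
  let ?e = "z + \<i> * csqrt (1 - z\<^sup>2)"
  let ?c = "z - \<i> * csqrt (1 - z\<^sup>2)"
  have prod: "?e * ?c = 1"
    by (simp add: algebra_simps flip: power2_eq_square)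
  hence "?e \<noteq> 0" by auto
  hence e: "exp (\<i> * Arccos z) = ?e" by (simp add: Arccos_def)
  moreover have "exp (- (\<i> * Arccos z)) = ?c"
    using prod e by (simp add: exp_minus inverse_unique)
  ultimately show ?thesis by (simp add: sin_exp_eq)
qed

lemma csqrt_divide_4: "csqrt (z / 4) = csqrt z / 2"
  using csqrt_principal[of z] by (intro csqrt_unique) (auto simp: power_divide simp del: csqrt.simps)

text \<open>
  Differentiating \<open>Q m (2 cos t - 2) = 2 cos (m t)\<close> in \<open>t\<close> rather than in \<open>x\<close> avoids the derivative of
  \<open>Arccos\<close>, and with it the branch cuts.
\<close>
lemma Q_deriv:
  assumes "x \<noteq> 0" "x \<noteq> -4"
  shows "poly (pderiv (Q m)) x
    = 2 * of_nat m * sin (of_nat m * Arccos (1 + x / 2)) / csqrt (- x * (4 + x))"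
proof -
  define t where "t = Arccos (1 + x / 2)"
  have x: "x = 2 * cos t - 2" by (simp add: t_def)
  have "1 - (1 + x / 2)\<^sup>2 = (- x * (4 + x)) / 4" by (simp add: power2_eq_square field_simps)
  hence "sin t = csqrt (- x * (4 + x)) / 2"
    by (simp only: t_def sin_Arccos_csqrt csqrt_divide_4)
  hence s: "csqrt (- x * (4 + x)) = 2 * sin t" by (metis mult.commute nonzero_eq_divide_eq zero_neq_numeral)
  have "csqrt (- x * (4 + x)) \<noteq> 0"
    using assms by (simp add: add_eq_0_iff del: csqrt.simps)
  hence s0: "sin t \<noteq> 0" unfolding s by simp
  have "((\<lambda>t. poly (Q m) (2 * cos t - 2)) has_field_derivative
      poly (pderiv (Q m)) (2 * cos t - 2) * (- 2 * sin t)) (at t)"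
    by (rule DERIV_chain2[OF poly_DERIV]) (auto intro!: derivative_eq_intros)
  moreover have "((\<lambda>t. 2 * cos (of_nat m * t)) has_field_derivative
      - 2 * of_nat m * sin (of_nat m * t)) (at t)"
    by (auto intro!: derivative_eq_intros)
  ultimately have "poly (pderiv (Q m)) x * (- 2 * sin t) = - 2 * of_nat m * sin (of_nat m * t)"
    unfolding poly_Q_cos x[symmetric] by (rule DERIV_unique)
  with s0 show ?thesis
    unfolding s t_def[symmetric] by (simp add: field_simps)
qed

section \<open>The generating function\<close>

lemma pochhammer_half_sums:
  fixes z :: complex
  assumes "norm z < 1"
  shows "(\<lambda>k. pochhammer (1/2) k / fact k * z ^ k) sums (1 / csqrt (1 - z))"
proof -
  have "(\<lambda>k. ((-1/2) gchoose k) * (-z) ^ k) sums (1 + (-z)) powr (-1/2)"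
    using assms by (intro gen_binomial_complex) simp
  moreover have "((-1/2) gchoose k) * (-z) ^ k = pochhammer (1/2) k / fact k * z ^ k" for k
  proof -
    have "((-1/2) gchoose k) * (-z) ^ k = ((-1) ^ k * (-1) ^ k) * (pochhammer (1/2) k / fact k * z ^ k)"
      by (simp add: gbinomial_pochhammer power_minus[of z])
    also have "(-1) ^ k * (-1) ^ k = (1 :: complex)"
      by (simp flip: power_mult_distrib)
    finally show ?thesis by simp
  qed
  moreover have "(1 + (-z)) powr (-1/2) = 1 / csqrt (1 - z)"
    using powr_minus_divide[of "1 - z" "1/2"] by (simp add: csqrt_conv_powr)
  ultimately show ?thesis by simp
qed

lemma abs_Im_csqrt_less_Re:
  assumes "0 < Re z"
  shows "\<bar>Im (csqrt z)\<bar> < Re (csqrt z)"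
proof -
  have "(Re (csqrt z))^2 - (Im (csqrt z))^2 = Re ((csqrt z)^2)"
    by (simp add: Re_power2 del: csqrt.simps power2_csqrt)
  also have "\<dots> > 0" using assms by (simp del: csqrt.simps)
  finally have "(Im (csqrt z))^2 < (Re (csqrt z))^2" by simp
  thus ?thesis
    by (intro power2_less_imp_less[OF _ Re_csqrt]) (simp del: csqrt.simps)
qed

text \<open>
  Square roots of numbers in the right half-plane have argument less than \<open>pi / 4\<close> in absolute
  value, so a product of two of them stays in the right half-plane and is therefore the principal
  root of the product of the radicands.
\<close>
lemma Re_csqrt_mult_csqrt_pos:
  assumes "0 < Re z" "0 < Re w"
  shows "0 < Re (csqrt z * csqrt w)"
proof -
  have "\<bar>Im (csqrt z) * Im (csqrt w)\<bar> < Re (csqrt z) * Re (csqrt w)"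
    unfolding abs_mult
    using abs_Im_csqrt_less_Re[OF assms(1)] abs_Im_csqrt_less_Re[OF assms(2)]
    by (intro mult_strict_mono') auto
  thus ?thesis by (simp del: csqrt.simps)
qed

lemma csqrt_mult_Re_pos:
  assumes "0 < Re z" "0 < Re w"
  shows "csqrt (z * w) = csqrt z * csqrt w"
  using Re_csqrt_mult_csqrt_pos[OF assms]
  by (intro csqrt_unique) (simp_all add: power_mult_distrib del: csqrt.simps)

lemma Re_one_minus_pos: "norm z < 1 \<Longrightarrow> 0 < Re (1 - z)"
  using complex_Re_le_cmod[of z] by simp

text \<open>
  With \<open>A\<close> and \<open>B\<close> the roots of \<open>1 - a\<close> and \<open>1 - b\<close>, one has \<open>R = A B\<close> and
  \<open>(1 - r + R) (1 + r + R) = 1 + 2 R + R\<^sup>2 - a b = (A + B)\<^sup>2\<close>. Both \<open>A + B\<close> and the product of the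
  two roots on the right have positive real part, which excludes the opposite sign.
\<close>
lemma inverse_csqrt_add:
  fixes a b r :: complex
  assumes a: "norm a < 1" and b: "norm b < 1" and ab: "a * b = r\<^sup>2"
  defines "R \<equiv> csqrt ((1 - a) * (1 - b))"
  shows "1 / csqrt (1 - a) + 1 / csqrt (1 - b) = inverse R * csqrt (1 - r + R) * csqrt (1 + r + R)"
proof -
  define A B where "A = csqrt (1 - a)" and "B = csqrt (1 - b)"
  have pos: "0 < Re (1 - a)" "0 < Re (1 - b)"
    using a b by (simp_all only: Re_one_minus_pos)
  have R: "R = A * B" "0 < Re R"
    using pos by (simp_all only: R_def A_def B_def csqrt_mult_Re_pos Re_csqrt_mult_csqrt_pos)
  have sq: "A\<^sup>2 = 1 - a" "B\<^sup>2 = 1 - b" by (simp_all add: A_def B_def)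
  have "norm r ^ 2 < 1"
    using mult_strict_mono'[OF a b] by (simp flip: norm_power norm_mult add: ab[symmetric])
  hence r: "norm r < 1" by (simp add: abs_square_less_1)
  have rpos: "0 < Re (1 - r + R)" "0 < Re (1 + r + R)"
    using Re_one_minus_pos[of r] Re_one_minus_pos[of "-r"] r R(2) by simp_all
  have AB: "0 < Re (A + B)"
    using abs_Im_csqrt_less_Re[OF pos(1)] abs_Im_csqrt_less_Re[OF pos(2)]
    unfolding A_def B_def by (simp del: csqrt.simps)
  have "(1 - r + R) * (1 + r + R) = (A + B)\<^sup>2"
    using sq ab unfolding R by algebra
  hence "csqrt (1 - r + R) * csqrt (1 + r + R) = csqrt ((A + B)\<^sup>2)"
    using csqrt_mult_Re_pos[OF rpos] by simp
  also have "\<dots> = A + B" using AB by (intro csqrt_square) simp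
  finally have "csqrt (1 - r + R) * csqrt (1 + r + R) = A + B" .
  moreover have "A \<noteq> 0" "B \<noteq> 0" using R by auto
  ultimately show ?thesis
    unfolding A_def[symmetric] B_def[symmetric] mult.assoc
    by (simp add: R(1) field_simps)
qed

text \<open>
  The roots of \<open>1 - (2 + x) t + t\<^sup>2\<close> are the numbers \<open>u\<close>, \<open>v\<close> with \<open>u v = 1\<close> and \<open>x = u + v - 2\<close>, so the
  condition on \<open>r\<close> says that \<open>v r\<close> and \<open>u r\<close> lie in the unit disc: it is the condition for both
  binomial series to converge.
\<close>
lemma Q_generating_function:
  fixes x r :: complex
  assumes "\<forall>t. 1 - 2 * t - x * t + t\<^sup>2 = 0 \<longrightarrow> norm r < norm t"
  defines "R \<equiv> csqrt (1 - 2 * r - x * r + r\<^sup>2)"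
  shows "(\<lambda>k. pochhammer (1/2) k / fact k * poly (Q k) x * r ^ k) sums
    (inverse R * csqrt (1 - r + R) * csqrt (1 + r + R))"
proof -
  obtain t where t: "x = 2 * cos t - 2" using exists_cos_parameter by blast
  define u v where "u = exp (\<i> * t)" and "v = exp (- (\<i> * t))"
  have uv: "u * v = 1" by (simp add: u_def v_def flip: exp_add)
  have x: "x = u + v - 2" by (simp add: t cos_exp_eq u_def v_def)
  have "1 - 2 * u - x * u + u\<^sup>2 = 0" "1 - 2 * v - x * v + v\<^sup>2 = 0"
    using uv unfolding x by algebra+
  hence r: "norm r < norm u" "norm r < norm v"
    using assms(1) by blast+
  have uv': "norm u * norm v = 1"
    using uv by (simp flip: norm_mult)
  have pos: "0 < norm u" "0 < norm v"
    by (simp_all add: u_def v_def)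
  have ur: "norm (u * r) < 1"
    using mult_strict_left_mono[OF r(2) pos(1)] uv' by (simp add: norm_mult)
  have vr: "norm (v * r) < 1"
    using mult_strict_left_mono[OF r(1) pos(2)] uv' by (simp add: norm_mult mult.commute)
  have "(\<lambda>k. pochhammer (1/2) k / fact k * (u * r) ^ k + pochhammer (1/2) k / fact k * (v * r) ^ k) sums
      (1 / csqrt (1 - u * r) + 1 / csqrt (1 - v * r))"
    by (intro sums_add pochhammer_half_sums ur vr)
  moreover have "pochhammer (1/2) k / fact k * (u * r) ^ k + pochhammer (1/2) k / fact k * (v * r) ^ k
      = pochhammer (1/2) k / fact k * poly (Q k) x * r ^ k" for k
    by (simp add: x poly_Q_Joukowski[OF uv] power_mult_distrib algebra_simps add_divide_distrib)
  moreover have "u * r * (v * r) = r\<^sup>2" using uv by algebra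
  moreover have "(1 - u * r) * (1 - v * r) = 1 - 2 * r - x * r + r\<^sup>2"
    using uv unfolding x by algebra
  ultimately show ?thesis
    using inverse_csqrt_add[OF ur vr, of r] by (simp add: R_def del: csqrt.simps)
qed

section \<open>The collected identities\<close>

theorem theorem9:
  fixes m n :: nat and x y r :: complex
  shows
    "(x \<noteq> y \<longrightarrow>
        (\<Sum>k=0..n. poly (P k) y * poly (P k) x)
          = (poly (P (n+1)) x * poly (P n) y - poly (P (n+1)) y * poly (P n) x) / (x - y))
   \<and> ((\<lambda>z. (poly (P (n+1)) x * poly (P n) z - poly (P (n+1)) z * poly (P n) x) / (x - z))
        \<longlongrightarrow> deriv (poly (P (n+1))) x * poly (P n) x - poly (P (n+1)) x * deriv (poly (P n)) x) (at x)
   \<and> (\<Sum>k=0..n. (poly (P k) x)^2)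
        = deriv (poly (P (n+1))) x * poly (P n) x - poly (P (n+1)) x * deriv (poly (P n)) x
   \<and> (m \<ge> 1 \<and> x \<noteq> 0 \<and> x \<noteq> -4 \<longrightarrow>
        (poly (P m) has_field_derivative
           1 / (x * (4 + x)) * (- (2 * of_nat m + 1) * poly (P (m-1)) x
                                 + (of_nat m * (x + 2) - 1) * poly (P m) x)) (at x))
   \<and> raise_op m (poly (P m)) x = (2 * of_nat m + 1) * poly (P (m+1)) x
   \<and> (m \<ge> 1 \<longrightarrow> lower_op m (poly (P m)) x = (2 * of_nat m + 1) * poly (P (m-1)) x)
   \<and> ode_P m (poly (P m)) x = 0
   \<and> (\<forall>S f. open S \<and> f holomorphic_on S \<longrightarrow>
        ((\<forall>z\<in>S. ode_P m f z = 0) \<longleftrightarrow>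
         (\<forall>z\<in>S. lower_op (m+1) (raise_op m f) z = (2 * of_nat m + 1) * (2 * of_nat m + 3) * f z)))
   \<and> (m \<ge> 1 \<longrightarrow> (\<forall>S f. open S \<and> f holomorphic_on S \<longrightarrow>
        ((\<forall>z\<in>S. ode_P m f z = 0) \<longleftrightarrow>
         (\<forall>z\<in>S. raise_op (m-1) (lower_op m f) z = (2 * of_nat m - 1) * (2 * of_nat m + 1) * f z))))
   \<and> (poly (Q m) x)^2 = poly (Q (2*m)) x + 2
   \<and> ((\<forall>t. 1 - 2 * t - x * t + t^2 = 0 \<longrightarrow> norm r < norm t) \<longrightarrow>
        (let R = csqrt (1 - 2 * r - x * r + r^2) in
          (\<lambda>k. pochhammer (1/2) k / fact k * poly (Q k) x * r ^ k) sums
            (inverse R * csqrt (1 - r + R) * csqrt (1 + r + R))))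
   \<and> (x \<noteq> 0 \<and> x \<noteq> -4 \<longrightarrow>
        (poly (Q m) has_field_derivative
           2 * of_nat m * sin (of_nat m * Arccos (1 + x/2)) / csqrt (- x * (4 + x))) (at x))"
proof (intro conjI impI allI)
  show "(\<Sum>k=0..n. poly (P k) y * poly (P k) x)
      = (poly (P (n+1)) x * poly (P n) y - poly (P (n+1)) y * poly (P n) x) / (x - y)" if "x \<noteq> y"
    using that Christoffel_Darboux_P[of x y n] by (simp add: field_simps)
  show "((\<lambda>z. (poly (P (n+1)) x * poly (P n) z - poly (P (n+1)) z * poly (P n) x) / (x - z))
      \<longlongrightarrow> deriv (poly (P (n+1))) x * poly (P n) x - poly (P (n+1)) x * deriv (poly (P n)) x) (at x)"
    using Christoffel_Darboux_P_tendsto[of n x]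
    by (simp add: deriv_poly Christoffel_Darboux_P_confluent)
  show "(\<Sum>k=0..n. (poly (P k) x)^2)
      = deriv (poly (P (n+1))) x * poly (P n) x - poly (P (n+1)) x * deriv (poly (P n)) x"
    by (simp add: deriv_poly Christoffel_Darboux_P_confluent)
  show lower: "lower_op m (poly (P m)) x = (2 * of_nat m + 1) * poly (P (m-1)) x" if "m \<ge> 1"
    using that lower_P[of "m - 1" x] by (simp add: of_nat_diff)
  show "(poly (P m) has_field_derivative
      1 / (x * (4 + x)) * (- (2 * of_nat m + 1) * poly (P (m-1)) x
                           + (of_nat m * (x + 2) - 1) * poly (P m) x)) (at x)"
    if "m \<ge> 1 \<and> x \<noteq> 0 \<and> x \<noteq> -4"
  proof -
    have "x * (4 + x) \<noteq> 0" using that by (simp add: add_eq_0_iff)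
    moreover have "poly (pderiv (P m)) x * (x * (4 + x))
        = - (2 * of_nat m + 1) * poly (P (m-1)) x + (of_nat m * (x + 2) - 1) * poly (P m) x"
      using lower that by (simp add: lower_op_def deriv_poly algebra_simps)
    ultimately have "poly (pderiv (P m)) x = 1 / (x * (4 + x)) *
        (- (2 * of_nat m + 1) * poly (P (m-1)) x + (of_nat m * (x + 2) - 1) * poly (P m) x)"
      by (simp only: times_divide_eq_left mult_1_left nonzero_eq_divide_eq not_False_eq_True)
    thus ?thesis using poly_DERIV[of "P m" x] by simp
  qed
  show "raise_op m (poly (P m)) x = (2 * of_nat m + 1) * poly (P (m+1)) x"
    by (simp add: raise_P)
  show "ode_P m (poly (P m)) x = 0"
    by (rule ode_P_P)
  show "(\<forall>z\<in>S. ode_P m f z = 0) \<longleftrightarrow>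
      (\<forall>z\<in>S. lower_op (m+1) (raise_op m f) z = (2 * of_nat m + 1) * (2 * of_nat m + 3) * f z)"
    if "open S \<and> f holomorphic_on S" for S f
    using that ode_P_iff_lower_raise by blast
  show "(\<forall>z\<in>S. ode_P m f z = 0) \<longleftrightarrow>
      (\<forall>z\<in>S. raise_op (m-1) (lower_op m f) z = (2 * of_nat m - 1) * (2 * of_nat m + 1) * f z)"
    if "m \<ge> 1" "open S \<and> f holomorphic_on S" for S f
    using that ode_P_iff_raise_lower[of S f "m - 1"] by (simp add: of_nat_diff add_ac)
  show "(poly (Q m) x)^2 = poly (Q (2*m)) x + 2"
    by (rule Q_square)
  show "let R = csqrt (1 - 2 * r - x * r + r^2) in
      (\<lambda>k. pochhammer (1/2) k / fact k * poly (Q k) x * r ^ k) sums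
        (inverse R * csqrt (1 - r + R) * csqrt (1 + r + R))"
    if "\<forall>t. 1 - 2 * t - x * t + t^2 = 0 \<longrightarrow> norm r < norm t"
    unfolding Let_def by (rule Q_generating_function[OF that])
  show "(poly (Q m) has_field_derivative
      2 * of_nat m * sin (of_nat m * Arccos (1 + x/2)) / csqrt (- x * (4 + x))) (at x)"
    if "x \<noteq> 0 \<and> x \<noteq> -4"
    using that Q_deriv[of x m] poly_DERIV[of "Q m" x] by simp
qed

end
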